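(* Let $n, m \in \mathbb{N}$, $i \in \{1,\dots,n\}$ and let $g \colon I^n \to \mathbb{R}^m$ be a continuous function. Then the sets $\mathsf{Conn}_i(g)$ and $\mathsf{Sep}_i(g)$ are compact. Furthermore, these sets are connected provided that $m = 1$.
   Context: $I^n = [0,1]^n$; for $i \in \{1,\dots,n\}$, $I^n_{i,-} = \{z \in I^n : z_i = 0\}$ and $I^n_{i,+} = \{z \in I^n : z_i = 1\}$. A subset $A \subset I^n$ connects $i$th opposite faces of $I^n$ if there is a connected subset $S \subset A$ with $S \cap I^n_{i,-} \ne \emptyset \ne S \cap I^n_{i,+}$; $A$ separates $i$th opposite faces of $I^n$ if $I^n \setminus A$ does not connect $i$th opposite faces of $I^n$. For a continuous $g \colon I^n \to \mathbb{R}^m$, $\mathsf{Conn}_i(g)$ is the set of all $p \in \mathbb{R}^m$ such that $g^{-1}[\{p\}]$ connects $i$th opposite faces of $I^n$, and $\mathsf{Sep}_i(g)$ is the set of all $p \in \mathbb{R}^m$ such that $g^{-1}[\{p\}]$ separates $i$th opposite faces of $I^n$. The empty set is regarded as compact and connected. *)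

theory Defs
  imports "HOL-Analysis.Analysis"
begin

text \<open>Coordinates of \<open>I\<^sup>n\<close> are indexed by a finite type \<open>'n\<close> with \<open>CARD('n) = n\<close>;
  as \<open>1\<close> in \<open>real ^ 'n\<close> is the all-ones vector, \<open>I\<^sup>n\<close> is \<open>cbox 0 1\<close>.\<close>

definition unit_cube :: "(real ^ 'n) set" where
  "unit_cube = cbox 0 1"

definition face_minus :: "'n \<Rightarrow> (real ^ 'n) set" where
  "face_minus i = {z \<in> unit_cube. z $ i = 0}"

definition face_plus :: "'n \<Rightarrow> (real ^ 'n) set" where
  "face_plus i = {z \<in> unit_cube. z $ i = 1}"

definition connects_faces :: "'n \<Rightarrow> (real ^ 'n) set \<Rightarrow> bool" where
  "connects_faces i A \<longleftrightarrow>
     (\<exists>S. S \<subseteq> A \<and> connected S \<and> S \<inter> face_minus i \<noteq> {} \<and> S \<inter> face_plus i \<noteq> {})"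

definition separates_faces :: "'n \<Rightarrow> (real ^ 'n) set \<Rightarrow> bool" where
  "separates_faces i A \<longleftrightarrow> \<not> connects_faces i (unit_cube - A)"

text \<open>The codomain \<open>\<real>\<^sup>m\<close> is \<open>Euclidean_space m\<close>, whose points are the functions
  \<open>nat \<Rightarrow> real\<close> vanishing at all indices \<open>\<ge> m\<close>. Unlike \<open>real ^ 'm\<close>, it
  includes \<open>m = 0\<close>.\<close>

definition fibre :: "(real ^ 'n \<Rightarrow> nat \<Rightarrow> real) \<Rightarrow> (nat \<Rightarrow> real) \<Rightarrow> (real ^ 'n) set" where
  "fibre g p = {z \<in> unit_cube. g z = p}"

definition Conn :: "nat \<Rightarrow> 'n \<Rightarrow> (real ^ 'n \<Rightarrow> nat \<Rightarrow> real) \<Rightarrow> (nat \<Rightarrow> real) set" where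
  "Conn m i g = {p \<in> topspace (Euclidean_space m). connects_faces i (fibre g p)}"

definition Sep :: "nat \<Rightarrow> 'n \<Rightarrow> (real ^ 'n \<Rightarrow> nat \<Rightarrow> real) \<Rightarrow> (nat \<Rightarrow> real) set" where
  "Sep m i g = {p \<in> topspace (Euclidean_space m). separates_faces i (fibre g p)}"

end

theory Submission
  imports Defs
begin

text \<open>Closedness of \<open>Conn\<close>: a compact fibre that does not connect the faces splits, by the
  cut-wire theorem, into two disjoint compact pieces, and nearby fibres stay close to this
  splitting. Closedness of \<open>Sep\<close>: a connected set joining the faces off a fibre can be replaced
  by a path, which by compactness also avoids all nearby fibres.

  For \<open>m = 1\<close>, connectedness of \<open>Sep\<close> is the intermediate value theorem. Connectedness of \<open>Conn\<close>
  is a form of unicoherence of the cube: if closed sets \<open>L\<close>, \<open>M\<close> cover the cube and both connect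
  the faces, so does \<open>L \<inter> M\<close>. Otherwise \<open>L \<inter> M = A \<union> B\<close> splits; take a Urysohn
  function \<open>u\<close> that is \<open>0\<close> on \<open>A\<close> and the one face, \<open>1\<close> on \<open>B\<close> and the other face. Then
  \<open>exp (\<pi> \<i> u)\<close> on \<open>L\<close> and \<open>exp (- \<pi> \<i> u)\<close> on \<open>M\<close> glue to a map that has a
  logarithm on the cube, whose increment between the faces would have to be both \<open>\<pi> \<i>\<close>
  (along \<open>L\<close>) and \<open>- \<pi> \<i>\<close> (along \<open>M\<close>).\<close>

section \<open>Uniqueness of continuous logarithms on connected sets\<close>

lemma exp_eq_diff_constant:
  fixes f g :: "'a::topological_space \<Rightarrow> complex"
  assumes "connected S" "continuous_on S f" "continuous_on S g"
    and eq: "\<And>x. x \<in> S \<Longrightarrow> exp (f x) = exp (g x)"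
    and "x \<in> S" "y \<in> S"
  shows "f x - g x = f y - g y"
proof -
  have "(\<lambda>x. f x - g x) constant_on S"
  proof (rule continuous_discrete_range_constant[OF assms(1)])
    show "continuous_on S (\<lambda>x. f x - g x)"
      using assms by (intro continuous_intros)
    fix x assume "x \<in> S"
    have "2 * pi \<le> norm ((f y - g y) - (f x - g x))"
      \<comment> \<open>All values of the difference lie in one coset of the multiples of 2 pi i, so
        distinct values are at least 2 pi apart, and a continuous function with such a range is
        constant on a connected set.\<close>
      if "y \<in> S" "f y - g y \<noteq> f x - g x" for y
    proof -
      have "exp (f y - g y) = exp (f x - g x)"
        using eq \<open>x \<in> S\<close> \<open>y \<in> S\<close> by (simp add: exp_diff)
      then obtain n :: int where n: "f y - g y = (f x - g x) + (of_int (2 * n) * pi) * \<i>"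
        unfolding exp_eq by blast
      with that have "n \<noteq> 0" by auto
      then have "1 \<le> \<bar>real_of_int n\<bar>" by linarith
      then show ?thesis
        using n by (simp add: norm_mult abs_mult)
    qed
    then show "\<exists>e>0. \<forall>y. y \<in> S \<and> f y - g y \<noteq> f x - g x \<longrightarrow> e \<le> norm ((f y - g y) - (f x - g x))"
      by (intro exI[of _ "2 * pi"]) auto
  qed
  then show ?thesis
    using assms(5,6) unfolding constant_on_def by metis
qed

section \<open>The cube and its faces\<close>

lemma compact_unit_cube: "compact unit_cube"
  and convex_unit_cube: "convex unit_cube"
  by (auto simp: unit_cube_def)

lemma closed_face_minus: "closed (face_minus i)"
  and closed_face_plus: "closed (face_plus i)"
  and convex_face_minus: "convex (face_minus i)"
  and convex_face_plus: "convex (face_plus i)"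
proof -
  have m: "face_minus i = unit_cube \<inter> {z. axis i 1 \<bullet> z = 0}"
    and p: "face_plus i = unit_cube \<inter> {z. axis i 1 \<bullet> z = 1}"
    by (auto simp: face_minus_def face_plus_def inner_axis')
  show "closed (face_minus i)" "closed (face_plus i)"
    unfolding m p using compact_unit_cube by (auto intro!: closed_Int closed_hyperplane compact_imp_closed)
  show "convex (face_minus i)" "convex (face_plus i)"
    unfolding m p by (auto intro!: convex_Int convex_hyperplane convex_unit_cube)
qed

lemma face_minus_subset: "face_minus i \<subseteq> unit_cube"
  and face_plus_subset: "face_plus i \<subseteq> unit_cube"
  by (auto simp: face_minus_def face_plus_def)

lemma faces_disjoint: "face_minus i \<inter> face_plus i = {}"
  by (auto simp: face_minus_def face_plus_def)

lemma connects_faces_mono: "connects_faces i A \<Longrightarrow> A \<subseteq> B \<Longrightarrow> connects_faces i B"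
  unfolding connects_faces_def by blast

lemma connects_faces_unit_cube:
  fixes i :: "'n::finite"
  shows "connects_faces i unit_cube"
proof -
  have "(0::real^'n) \<in> unit_cube \<inter> face_minus i" "(1::real^'n) \<in> unit_cube \<inter> face_plus i"
    by (auto simp: unit_cube_def face_minus_def face_plus_def mem_box_cart)
  then show ?thesis
    unfolding connects_faces_def using convex_connected[OF convex_unit_cube] by blast
qed

section \<open>Splitting of non-connecting sets and unicoherence of the cube\<close>

lemma not_connects_faces_split:
  assumes "compact F" "\<not> connects_faces i F"
  obtains A B where "compact A" "compact B" "A \<union> B = F" "A \<inter> B = {}"
    "A \<inter> face_plus i = {}" "B \<inter> face_minus i = {}"
proof -
  have "separated_between (top_of_set F) (F \<inter> face_minus i) (F \<inter> face_plus i)"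
  proof (rule cut_wire_fence_theorem)
    show "compact_space (top_of_set F)"
      using assms by (simp add: compact_space_subtopology)
    show "Hausdorff_space (top_of_set F)"
      by (simp add: Hausdorff_space_subtopology)
    show "closedin (top_of_set F) (F \<inter> face_minus i)" "closedin (top_of_set F) (F \<inter> face_plus i)"
      by (auto intro: closedin_closed_Int closed_face_minus closed_face_plus)
    show "disjnt C (F \<inter> face_minus i) \<or> disjnt C (F \<inter> face_plus i)"
      if "connectedin (top_of_set F) C" for C
      using that assms(2) unfolding connects_faces_def disjnt_def
      by (auto simp: connectedin_subtopology)
  qed
  then obtain A B where AB: "closedin (top_of_set F) A" "closedin (top_of_set F) B" "A \<union> B = F"
      "A \<inter> B = {}" "F \<inter> face_minus i \<subseteq> A" "F \<inter> face_plus i \<subseteq> B"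
    unfolding separated_between_alt by (auto simp: disjnt_def)
  show thesis
  proof
    show "compact A" "compact B"
      using AB assms(1) closedin_compact by blast+
    show "A \<inter> face_plus i = {}" "B \<inter> face_minus i = {}"
      using AB by blast+
  qed (use AB in auto)
qed

lemma connects_faces_Int:
  fixes i :: "'n::finite"
  assumes "compact L" "compact M" and LM: "L \<union> M = unit_cube"
    and "connects_faces i L" "connects_faces i M"
  shows "connects_faces i (L \<inter> M)"
proof (rule ccontr)
  assume "\<not> connects_faces i (L \<inter> M)"
  then obtain A B where AB: "compact A" "compact B" "A \<union> B = L \<inter> M" "A \<inter> B = {}"
      "A \<inter> face_plus i = {}" "B \<inter> face_minus i = {}"
    using not_connects_faces_split compact_Int[OF assms(1,2)] by metis
  \<comment> \<open>Adding the faces keeps the two sets disjoint, so \<open>u\<close> can be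
    prescribed on the faces together with \<open>A\<close> and \<open>B\<close>.\<close>
  have "(A \<union> face_minus i) \<inter> (B \<union> face_plus i) = {}"
    using AB faces_disjoint by blast
  moreover have "closed (A \<union> face_minus i)" "closed (B \<union> face_plus i)"
    by (simp_all add: AB(1,2) closed_Un closed_face_minus closed_face_plus compact_imp_closed)
  ultimately obtain u :: "real^'n \<Rightarrow> real" where u: "continuous_on UNIV u"
    and u0: "\<And>x. x \<in> A \<union> face_minus i \<Longrightarrow> u x = 0"
    and u1: "\<And>x. x \<in> B \<union> face_plus i \<Longrightarrow> u x = 1"
    using Urysohn[of "A \<union> face_minus i" "B \<union> face_plus i" "0::real" 1] by metis
  define v where "v = (\<lambda>x. complex_of_real (pi * u x) * \<i>)"
  have v: "continuous_on T v" for T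
    unfolding v_def using continuous_on_subset[OF u subset_UNIV]
    by (intro continuous_intros)
  have v0: "v x = 0" if "x \<in> A \<union> face_minus i" for x
    using u0[OF that] by (simp add: v_def)
  have v1: "v x = pi * \<i>" if "x \<in> B \<union> face_plus i" for x
    using u1[OF that] by (simp add: v_def)
  define h where "h = (\<lambda>x. if x \<in> L then exp (v x) else exp (- v x))"
  \<comment> \<open>On the overlap \<open>v\<close> is 0 or pi i, and exp takes the same value at pi
    i and at - pi i. Hence the two branches of \<open>h\<close> paste continuously along the closed
    sets \<open>L\<close> and \<open>M\<close>.\<close>
  have agree: "exp (v x) = exp (- v x)" if "x \<in> L" "x \<in> M" for x
  proof -
    have "x \<in> A \<or> x \<in> B" using that AB by blast
    then show ?thesis using v0 v1 by (auto simp: exp_minus mult.commute)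
  qed
  have "continuous_on (L \<union> M) h"
    unfolding h_def using assms(1,2) agree
    by (intro continuous_on_If continuous_intros v) (auto intro: compact_imp_closed)
  then have "continuous_on unit_cube h" using LM by simp
  moreover have "contractible (unit_cube :: (real^'n) set)"
    by (simp add: convex_imp_contractible convex_unit_cube)
  moreover have "h x \<noteq> 0" for x by (simp add: h_def)
  ultimately obtain \<theta> where \<theta>: "continuous_on unit_cube \<theta>"
    and h: "\<And>x. x \<in> unit_cube \<Longrightarrow> h x = exp (\<theta> x)"
    using continuous_logarithm_on_contractible by metis
  \<comment> \<open>The joining sets in \<open>L\<close> and in \<open>M\<close> may end at
    different points of a face. Their increments are comparable because the logarithm is constant on
    each face: \<open>v\<close> is constant there and both branches of \<open>h\<close> equal
    \<open>exp (v z)\<close>.\<close>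
  have face: "\<theta> x = \<theta> y" if C: "C \<subseteq> unit_cube" "convex C"
    and C_cases: "C = face_minus i \<or> C = face_plus i" and "x \<in> C" "y \<in> C" for C x y
  proof -
    obtain c where c: "\<And>z. z \<in> C \<Longrightarrow> v z = c"
      using C_cases v0 v1 by blast
    have "exp (v z) = exp (- v z)" if "z \<in> C" for z
      using C_cases that v0[of z] v1[of z]
      by (auto simp: exp_minus mult.commute)
    then have "exp (\<theta> z) = exp (v z)" if "z \<in> C" for z
      using that h[of z] C(1) unfolding h_def by (metis subsetD)
    then have "\<theta> x - v x = \<theta> y - v y"
      using exp_eq_diff_constant[OF convex_connected[OF C(2)] continuous_on_subset[OF \<theta> C(1)] v]
        \<open>x \<in> C\<close> \<open>y \<in> C\<close> by blast
    then show ?thesis using c that by simp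
  qed
  obtain S a b where S: "S \<subseteq> L" "connected S" "a \<in> S" "a \<in> face_minus i" "b \<in> S" "b \<in> face_plus i"
    using assms(4) unfolding connects_faces_def by blast
  obtain T c d where T: "T \<subseteq> M" "connected T" "c \<in> T" "c \<in> face_minus i" "d \<in> T" "d \<in> face_plus i"
    using assms(5) unfolding connects_faces_def by blast
  have "\<theta> a - v a = \<theta> b - v b"
  proof (rule exp_eq_diff_constant[of S])
    show "exp (\<theta> x) = exp (v x)" if "x \<in> S" for x
    proof -
      have "x \<in> L" "x \<in> unit_cube" using that S(1) LM by blast+
      then show ?thesis using h[of x] by (simp add: h_def)
    qed
  qed (use S LM \<theta> v in \<open>auto intro: continuous_on_subset\<close>)
  \<comment> \<open>\<open>T\<close> may meet \<open>L\<close>, where \<open>h\<close> is defined by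
    the other branch; \<open>agree\<close> covers these points.\<close>
  moreover have "\<theta> c - (- v c) = \<theta> d - (- v d)"
  proof (rule exp_eq_diff_constant[of T])
    show "exp (\<theta> x) = exp (- v x)" if "x \<in> T" for x
    proof -
      have "x \<in> M" "x \<in> unit_cube" using that T(1) LM by blast+
      then show ?thesis using h[of x] agree[of x] by (simp add: h_def split: if_splits)
    qed
  qed (use T LM \<theta> v in \<open>auto intro!: continuous_intros intro: continuous_on_subset\<close>)
  moreover have "\<theta> a = \<theta> c" "\<theta> b = \<theta> d"
    using S T face[OF face_minus_subset convex_face_minus] face[OF face_plus_subset convex_face_plus]
    by blast+
  ultimately have "pi * \<i> = - (pi * \<i>)"
    using S T v0 v1 by (simp add: algebra_simps)
  then show False by (simp add: complex_eq_iff)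
qed

text \<open>The closure of a connected subset of \<open>U\<close> may leave \<open>U\<close>, so it
  cannot serve as \<open>K\<close>. But a relatively open subset of a convex set is locally path
  connected, hence its components are path components, and the image of a path is compact.\<close>

lemma connects_faces_compact_subset:
  fixes i :: "'n::finite"
  assumes "openin (top_of_set unit_cube) U" "connects_faces i U"
  obtains K where "compact K" "K \<subseteq> U" "connects_faces i K"
proof -
  obtain S a b where S: "S \<subseteq> U" "connected S" "a \<in> S" "a \<in> face_minus i" "b \<in> S" "b \<in> face_plus i"
    using assms(2) unfolding connects_faces_def by blast
  have "locally path_connected U"
    using convex_imp_locally_path_connected[OF convex_unit_cube] assms(1) locally_open_subset by blast
  moreover have "connected_component U a b"
    using S unfolding connected_component_def by blast
  ultimately have "path_component U a b"
    by (simp add: path_component_eq_connected_component)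
  then obtain p where p: "path p" "path_image p \<subseteq> U" "pathstart p = a" "pathfinish p = b"
    unfolding path_component_def by blast
  show thesis
  proof
    show "compact (path_image p)" "path_image p \<subseteq> U"
      using p compact_path_image by auto
    have "a \<in> path_image p" "b \<in> path_image p"
      using p pathstart_in_path_image pathfinish_in_path_image by blast+
    then show "connects_faces i (path_image p)"
      unfolding connects_faces_def using S connected_path_image[OF p(1)] by blast
  qed
qed

section \<open>Compactness of \<open>Conn\<close> and \<open>Sep\<close>\<close>

lemma compactin_image_unit_cube:
  assumes "continuous_map (top_of_set unit_cube) X g" "compact K" "K \<subseteq> unit_cube"
  shows "compactin X (g ` K)"
  using assms by (intro image_compactin[of "top_of_set unit_cube"]) (auto simp: compactin_subtopology)

lemma Hausdorff_space_Euclidean_space: "Hausdorff_space (Euclidean_space m)"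
  by (simp add: metrizable_Euclidean_space metrizable_imp_Hausdorff_space)

lemma compact_fibre:
  assumes "continuous_map (top_of_set unit_cube) (Euclidean_space m) g"
    and "p \<in> topspace (Euclidean_space m)"
  shows "compact (fibre g p)"
proof -
  have "closedin (Euclidean_space m) {p}"
    using assms(2) by (simp add: closedin_Hausdorff_sing_eq Hausdorff_space_Euclidean_space)
  then have "closedin (top_of_set unit_cube) (fibre g p)"
    using closedin_continuous_map_preimage[OF assms(1)] by (fastforce simp: fibre_def)
  then show ?thesis
    using closedin_compact compact_unit_cube by blast
qed

text \<open>Compact sets in a Hausdorff space are closed, so the complement of \<open>C\<close> is a
  neighbourhood of \<open>p\<close> missing \<open>S\<close>. In both applications \<open>C\<close>
  is the image under \<open>g\<close> of a compact part of the cube.\<close>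

lemma closedin_if_separated_by_compactin:
  assumes "Hausdorff_space X" "S \<subseteq> topspace X"
    and "\<And>p. p \<in> topspace X \<Longrightarrow> p \<notin> S \<Longrightarrow> \<exists>C. compactin X C \<and> p \<notin> C \<and> S \<subseteq> C"
  shows "closedin X S"
proof -
  have "\<exists>T. openin X T \<and> p \<in> T \<and> T \<subseteq> topspace X - S" if p: "p \<in> topspace X - S" for p
  proof -
    obtain C where "compactin X C" "p \<notin> C" "S \<subseteq> C"
      using assms(3) p by blast
    then show ?thesis
      using compactin_imp_closedin[OF assms(1)] p
      by (intro exI[of _ "topspace X - C"]) auto
  qed
  then show ?thesis
    unfolding closedin_def using assms(2) openin_subopen by blast
qed

lemma compactin_Conn:
  fixes i :: "'n::finite" and g :: "real ^ 'n \<Rightarrow> nat \<Rightarrow> real"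
  assumes "continuous_map (top_of_set unit_cube) (Euclidean_space m) g"
  shows "compactin (Euclidean_space m) (Conn m i g)"
proof (rule closed_compactin)
  show "compactin (Euclidean_space m) (g ` unit_cube)"
    using compactin_image_unit_cube[OF assms compact_unit_cube] by simp
  show "Conn m i g \<subseteq> g ` unit_cube"
    unfolding Conn_def connects_faces_def fibre_def by blast
  show "closedin (Euclidean_space m) (Conn m i g)"
  proof (rule closedin_if_separated_by_compactin[OF Hausdorff_space_Euclidean_space])
    show "Conn m i g \<subseteq> topspace (Euclidean_space m)"
      by (auto simp: Conn_def)
    fix p assume p: "p \<in> topspace (Euclidean_space m)" "p \<notin> Conn m i g"
    then have "\<not> connects_faces i (fibre g p)"
      by (simp add: Conn_def)
    then obtain A B where AB: "compact A" "compact B" "A \<union> B = fibre g p" "A \<inter> B = {}"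
        "A \<inter> face_plus i = {}" "B \<inter> face_minus i = {}"
      using not_connects_faces_split compact_fibre[OF assms p(1)] by metis
    have "(A \<union> face_minus i) \<inter> (B \<union> face_plus i) = {}"
      using AB faces_disjoint by blast
    moreover have "closed (A \<union> face_minus i)" "closed (B \<union> face_plus i)"
      by (simp_all add: AB(1,2) closed_Un closed_face_minus closed_face_plus compact_imp_closed)
    ultimately obtain U V where UV: "open U" "open V" "A \<union> face_minus i \<subseteq> U"
        "B \<union> face_plus i \<subseteq> V" "U \<inter> V = {}"
      using separation_normal by metis
    \<comment> \<open>The image of this set is the required \<open>C\<close>. It omits
      \<open>p\<close>, whose fibre lies in \<open>U\<close> and \<open>V\<close>. If it omits
      \<open>q\<close>, the fibre of \<open>q\<close> also lies in these disjoint open sets, which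
      contain the opposite faces, so no connected subset of it joins them.\<close>
    have "compact (unit_cube - (U \<union> V))"
      using UV compact_unit_cube by (intro compact_diff) auto
    then have "compactin (Euclidean_space m) (g ` (unit_cube - (U \<union> V)))"
      using compactin_image_unit_cube[OF assms] by blast
    moreover have "p \<notin> g ` (unit_cube - (U \<union> V))"
      using AB(3) UV by (auto simp: fibre_def)
    moreover have "q \<in> g ` (unit_cube - (U \<union> V))" if q: "q \<in> Conn m i g" for q
    proof (rule ccontr)
      assume "q \<notin> g ` (unit_cube - (U \<union> V))"
      then have "fibre g q \<subseteq> U \<union> V"
        by (auto simp: fibre_def)
      moreover obtain S where "S \<subseteq> fibre g q" "connected S"
          "S \<inter> face_minus i \<noteq> {}" "S \<inter> face_plus i \<noteq> {}"
        using q by (auto simp: Conn_def connects_faces_def)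
      ultimately show False
        using UV connectedD[of S U V] by blast
    qed
    ultimately show "\<exists>C. compactin (Euclidean_space m) C \<and> p \<notin> C \<and> Conn m i g \<subseteq> C"
      by blast
  qed
qed

lemma compactin_Sep:
  fixes i :: "'n::finite" and g :: "real ^ 'n \<Rightarrow> nat \<Rightarrow> real"
  assumes "continuous_map (top_of_set unit_cube) (Euclidean_space m) g"
  shows "compactin (Euclidean_space m) (Sep m i g)"
proof (rule closed_compactin)
  show "compactin (Euclidean_space m) (g ` unit_cube)"
    using compactin_image_unit_cube[OF assms compact_unit_cube] by simp
  show "Sep m i g \<subseteq> g ` unit_cube"
  proof
    fix p assume "p \<in> Sep m i g"
    \<comment> \<open>An empty fibre does not separate: its complement is the whole cube, which
      connects the faces.\<close>
    then have "unit_cube - fibre g p \<noteq> unit_cube"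
      using connects_faces_unit_cube[of i] unfolding Sep_def separates_faces_def by auto
    then show "p \<in> g ` unit_cube"
      by (auto simp: fibre_def)
  qed
  show "closedin (Euclidean_space m) (Sep m i g)"
  proof (rule closedin_if_separated_by_compactin[OF Hausdorff_space_Euclidean_space])
    show "Sep m i g \<subseteq> topspace (Euclidean_space m)"
      by (auto simp: Sep_def)
    fix p assume p: "p \<in> topspace (Euclidean_space m)" "p \<notin> Sep m i g"
    then have "connects_faces i (unit_cube - fibre g p)"
      by (simp add: Sep_def separates_faces_def)
    moreover have "openin (top_of_set unit_cube) (unit_cube - fibre g p)"
      using compact_fibre[OF assms p(1)]
      by (simp add: Diff_eq compact_imp_closed open_Compl openin_open_Int)
    ultimately obtain K where K: "compact K" "K \<subseteq> unit_cube - fibre g p" "connects_faces i K"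
      using connects_faces_compact_subset by metis
    \<comment> \<open>A single \<open>K\<close> serves all nearby points: whenever \<open>q\<close>
      is outside its image, \<open>K\<close> joins the faces off the fibre of
      \<open>q\<close>.\<close>
    have "compactin (Euclidean_space m) (g ` K)"
      using K by (intro compactin_image_unit_cube[OF assms]) auto
    moreover have "p \<notin> g ` K"
      using K by (auto simp: fibre_def)
    moreover have "q \<in> g ` K" if q: "q \<in> Sep m i g" for q
    proof (rule ccontr)
      assume "q \<notin> g ` K"
      then have "K \<subseteq> unit_cube - fibre g q"
        using K by (auto simp: fibre_def)
      then show False
        using q K(3) connects_faces_mono unfolding Sep_def separates_faces_def by blast
    qed
    ultimately show "\<exists>C. compactin (Euclidean_space m) C \<and> p \<notin> C \<and> Sep m i g \<subseteq> C"
      by blast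
  qed
qed

section \<open>Connectedness in the case m = 1\<close>

definition real_point :: "real \<Rightarrow> nat \<Rightarrow> real" where
  "real_point t = (\<lambda>j. if j < 1 then t else 0)"

lemma topspace_Euclidean_space_1: "topspace (Euclidean_space 1) = range real_point"
proof
  show "topspace (Euclidean_space 1) \<subseteq> range real_point"
  proof
    fix x assume "x \<in> topspace (Euclidean_space 1)"
    then have "x = real_point (x 0)"
      by (auto simp: topspace_Euclidean_space real_point_def fun_eq_iff)
    then show "x \<in> range real_point" by blast
  qed
qed (auto simp: topspace_Euclidean_space real_point_def)

lemma real_point_eq_iff: "x \<in> topspace (Euclidean_space 1) \<Longrightarrow> x = real_point t \<longleftrightarrow> x 0 = t"
  unfolding topspace_Euclidean_space_1 by (auto simp: real_point_def fun_eq_iff)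

text \<open>The parameters of \<open>S\<close> form an interval of reals, and \<open>S\<close> is
  its image under the continuous map \<open>real_point\<close>. Strict inequalities suffice because
  the endpoints are in \<open>S\<close> already.\<close>

lemma connectedin_Euclidean_space_1:
  assumes "S \<subseteq> topspace (Euclidean_space 1)"
    and "\<And>a b c. \<lbrakk>real_point a \<in> S; real_point b \<in> S; a < c; c < b\<rbrakk> \<Longrightarrow> real_point c \<in> S"
  shows "connectedin (Euclidean_space 1) S"
proof -
  have "is_interval {t. real_point t \<in> S}"
    unfolding is_interval_1 using assms(2) by (metis mem_Collect_eq order_le_less)
  then have "connectedin euclideanreal {t. real_point t \<in> S}"
    by (simp add: is_interval_connected_1)
  \<comment> \<open>The conditional in \<open>real_point\<close> has the shape that the
    componentwise continuity criterion for \<open>Euclidean_space\<close> expects.\<close>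
  moreover have "continuous_map euclideanreal (Euclidean_space 1) real_point"
    unfolding real_point_def continuous_map_componentwise_Euclidean_space by auto
  moreover have "real_point ` {t. real_point t \<in> S} = S"
    using assms(1) unfolding topspace_Euclidean_space_1 by blast
  ultimately show ?thesis
    using connectedin_continuous_map_image by metis
qed

context
  fixes i :: "'n::finite" and g :: "real ^ 'n \<Rightarrow> nat \<Rightarrow> real"
  assumes g: "continuous_map (top_of_set unit_cube) (Euclidean_space 1) g"
begin

lemma continuous_on_coordinate: "continuous_on unit_cube (\<lambda>z. g z 0)"
proof -
  have "continuous_map (Euclidean_space 1) euclideanreal (\<lambda>x. x 0)"
    unfolding Euclidean_space_def
    by (intro continuous_map_from_subtopology continuous_map_product_projection) auto
  then show ?thesis
    using continuous_map_compose[OF g] by (fastforce simp: o_def)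
qed

lemma fibre_real_point: "fibre g (real_point t) = {z \<in> unit_cube. g z 0 = t}"
proof -
  have "g z \<in> topspace (Euclidean_space 1)" if "z \<in> unit_cube" for z
    using continuous_map_image_subset_topspace[OF g] that by auto
  then show ?thesis
    unfolding fibre_def using real_point_eq_iff by blast
qed

lemma connectedin_Conn_1: "connectedin (Euclidean_space 1) (Conn 1 i g)"
proof (rule connectedin_Euclidean_space_1)
  show "Conn 1 i g \<subseteq> topspace (Euclidean_space 1)"
    by (auto simp: Conn_def)
  fix a b c
  assume "real_point a \<in> Conn 1 i g" "real_point b \<in> Conn 1 i g" and c: "a < c" "c < b"
  then have ab: "connects_faces i {z \<in> unit_cube. g z 0 = a}"
      "connects_faces i {z \<in> unit_cube. g z 0 = b}"
    by (auto simp: Conn_def fibre_real_point)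
  \<comment> \<open>These sets cover the cube and meet exactly in the fibre over \<open>c\<close>.
    The first contains the fibre over \<open>a\<close> and the second the fibre over
    \<open>b\<close>, so both connect the faces.\<close>
  let ?L = "{z \<in> unit_cube. g z 0 \<le> c}" and ?M = "{z \<in> unit_cube. c \<le> g z 0}"
  have "closed ?L" "closed ?M"
    by (intro continuous_on_closed_Collect_le continuous_on_coordinate continuous_on_const
        compact_imp_closed[OF compact_unit_cube])+
  then have "compact (unit_cube \<inter> ?L)" "compact (unit_cube \<inter> ?M)"
    using compact_unit_cube by blast+
  moreover have "unit_cube \<inter> ?L = ?L" "unit_cube \<inter> ?M = ?M" by auto
  moreover have "connects_faces i ?L" "connects_faces i ?M"
    using c by (auto intro: connects_faces_mono[OF ab(1)] connects_faces_mono[OF ab(2)])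
  moreover have "?L \<union> ?M = unit_cube" by auto
  ultimately have "connects_faces i (?L \<inter> ?M)"
    using connects_faces_Int[of ?L ?M i] by simp
  moreover have "?L \<inter> ?M = {z \<in> unit_cube. g z 0 = c}" by auto
  ultimately show "real_point c \<in> Conn 1 i g"
    by (auto simp: Conn_def fibre_real_point topspace_Euclidean_space_1
        simp del: One_nat_def)
qed

lemma connectedin_Sep_1: "connectedin (Euclidean_space 1) (Sep 1 i g)"
proof (rule connectedin_Euclidean_space_1)
  show "Sep 1 i g \<subseteq> topspace (Euclidean_space 1)"
    by (auto simp: Sep_def)
  fix a b c
  assume "real_point a \<in> Sep 1 i g" "real_point b \<in> Sep 1 i g" and c: "a < c" "c < b"
  then have ab: "\<not> connects_faces i (unit_cube - {z \<in> unit_cube. g z 0 = a})"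
      "\<not> connects_faces i (unit_cube - {z \<in> unit_cube. g z 0 = b})"
    by (auto simp: Sep_def separates_faces_def fibre_real_point)
  have "\<not> connects_faces i (unit_cube - {z \<in> unit_cube. g z 0 = c})"
  proof
    assume "connects_faces i (unit_cube - {z \<in> unit_cube. g z 0 = c})"
    then obtain S where S: "S \<subseteq> unit_cube" "\<forall>z\<in>S. g z 0 \<noteq> c" "connected S"
        "S \<inter> face_minus i \<noteq> {}" "S \<inter> face_plus i \<noteq> {}"
      unfolding connects_faces_def by blast
    \<comment> \<open>The values on \<open>S\<close> form an interval omitting \<open>c\<close>, so
      they cannot include both \<open>a\<close> and \<open>b\<close>. Thus \<open>S\<close> avoids
      one of those two fibres and joins the faces in its complement.\<close>
    have "connected ((\<lambda>z. g z 0) ` S)"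
      using S continuous_on_coordinate by (meson connected_continuous_image continuous_on_subset)
    moreover have "c \<in> {a..b}" "c \<notin> (\<lambda>z. g z 0) ` S"
      using S(2) c by auto
    ultimately have "a \<notin> (\<lambda>z. g z 0) ` S \<or> b \<notin> (\<lambda>z. g z 0) ` S"
      using connected_contains_Icc by blast
    then have "(\<forall>z\<in>S. g z 0 \<noteq> a) \<or> (\<forall>z\<in>S. g z 0 \<noteq> b)"
      by blast
    then have "S \<subseteq> unit_cube - {z \<in> unit_cube. g z 0 = a} \<or>
        S \<subseteq> unit_cube - {z \<in> unit_cube. g z 0 = b}"
      using S(1) by blast
    then show False
      using S(3-5) ab unfolding connects_faces_def by blast
  qed
  then show "real_point c \<in> Sep 1 i g"
    by (auto simp: Sep_def separates_faces_def fibre_real_point topspace_Euclidean_space_1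
        simp del: One_nat_def)
qed

end

theorem corollary5p12:
  fixes m :: nat and i :: "'n::finite" and g :: "real ^ 'n \<Rightarrow> nat \<Rightarrow> real"
  assumes "continuous_map (top_of_set unit_cube) (Euclidean_space m) g"
  shows "compactin (Euclidean_space m) (Conn m i g) \<and>
         compactin (Euclidean_space m) (Sep m i g) \<and>
         (m = 1 \<longrightarrow>
            connectedin (Euclidean_space m) (Conn m i g) \<and>
            connectedin (Euclidean_space m) (Sep m i g))"
proof (intro conjI impI)
  show "compactin (Euclidean_space m) (Conn m i g)" "compactin (Euclidean_space m) (Sep m i g)"
    using assms by (rule compactin_Conn compactin_Sep)+
  assume "m = 1"
  with assms have g: "continuous_map (top_of_set unit_cube) (Euclidean_space 1) g" by (simp only:)
  show "connectedin (Euclidean_space m) (Conn m i g)" "connectedin (Euclidean_space m) (Sep m i g)"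
    unfolding \<open>m = 1\<close> by (rule connectedin_Conn_1[OF g] connectedin_Sep_1[OF g])+
qed

end
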